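(* Let $G$ be a finite simple graph whose vertex set decomposes as a disjoint union $$V(G)=C\sqcup\{v\}\sqcup X,$$ where $C$ is a nonempty clique. Assume that every vertex of $C$ is adjacent to $v$ and to every vertex of $X$, while the vertex $v$ has no neighbors in $X$. Let $K$ be a field and $\mathcal{A}=K[x_y: y\in V(G)]$. Then the closed neighborhood ideal $CNI(G)\subseteq\mathcal{A}$ is separable, and hence satisfies the strong persistence property. Moreover, if $X\ne\varnothing$, then the monomial corresponding to $v$, $$u_v=\left(\prod_{c\in C}x_c\right)x_v,$$ is a split generator of $CNI(G)$.
   Context: For a vertex $y$ of $G$, the closed neighborhood is $N[y]=\{y\}\cup\{z\in V(G):\{y,z\}\in E(G)\}$. The closed neighborhood ideal of $G$ is the monomial ideal $$CNI(G)=\left(\prod_{z\in N[y]}x_z \;:\; y\in V(G)\right)\subseteq\mathcal{A}.$$ A monomial ideal $I\subseteq\mathcal{A}$ with unique minimal set of monomial generators $\mathcal{G}(I)=\{u_1,\dots,u_m\}$ is called separable if there exist an index $i$ with $1\le i\le m$ and monomials $w,g\in\mathcal{A}$ such that $w\ne 1$, $\gcd(w,g)=1$, $u_i=w\cdot g$, and $\gcd(u_j,u_i)=w$ for every $j\ne i$. The generator $u_i$ is then called a split generator of the separable ideal. The ideal $I$ satisfies the strong persistence property if $(I^{k+1}:_{\mathcal{A}} I)=I^k$ for all $k\ge 1$. *)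

theory Defs
  imports
    "Graph_Theory.Digraph"
    "HOL-Algebra.Ideal_Product"
    "HOL-Algebra.Divisibility"
    "HOL-Library.Poly_Mapping"
begin

text \<open>A polynomial maps exponent vectors to coefficients; \<open>poly_ring V\<close> consists of the
  polynomials in which only the indeterminates indexed by \<open>V\<close> occur.\<close>

type_synonym ('v, 'k) mpol = "('v \<Rightarrow>\<^sub>0 nat) \<Rightarrow>\<^sub>0 'k"

definition poly_ring :: "'v set \<Rightarrow> ('v, 'k::field) mpol ring" where
  "poly_ring V =
     \<lparr>carrier = {p. \<forall>m\<in>Poly_Mapping.keys p. Poly_Mapping.keys m \<subseteq> V},
      monoid.mult = (*), one = 1, zero = 0, add = (+)\<rparr>"

lemma cring_poly_ring: "cring (poly_ring V :: ('v, 'k::field) mpol ring)"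
proof (rule cringI)
  let ?A = "poly_ring V :: ('v, 'k) mpol ring"
  show "abelian_group ?A"
  proof (rule abelian_groupI)
    show "x \<oplus>\<^bsub>?A\<^esub> y \<in> carrier ?A" if "x \<in> carrier ?A" "y \<in> carrier ?A" for x y
      using that Poly_Mapping.keys_add[of x y] by (fastforce simp: poly_ring_def)
    show "\<exists>y\<in>carrier ?A. y \<oplus>\<^bsub>?A\<^esub> x = \<zero>\<^bsub>?A\<^esub>" if "x \<in> carrier ?A" for x
      using that by (intro bexI[of _ "- x"]) (auto simp: poly_ring_def)
  qed (auto simp: poly_ring_def add_ac)
  show "comm_monoid ?A"
  proof (rule comm_monoidI)
    show "x \<otimes>\<^bsub>?A\<^esub> y \<in> carrier ?A" if "x \<in> carrier ?A" "y \<in> carrier ?A" for x y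
    proof -
      have "Poly_Mapping.keys m \<subseteq> V" if m: "m \<in> Poly_Mapping.keys (x * y)" for m
      proof -
        obtain a b where "m = a + b" "a \<in> Poly_Mapping.keys x" "b \<in> Poly_Mapping.keys y"
          using m Poly_Mapping.keys_mult[of x y] by blast
        then show ?thesis
          using \<open>x \<in> carrier ?A\<close> \<open>y \<in> carrier ?A\<close> Poly_Mapping.keys_add[of a b]
          by (fastforce simp: poly_ring_def)
      qed
      then show ?thesis by (simp add: poly_ring_def)
    qed
  qed (auto simp: poly_ring_def mult_ac)
qed (auto simp: poly_ring_def distrib_right)

definition indet :: "'v \<Rightarrow> ('v, 'k::field) mpol" where
  "indet y = Poly_Mapping.single (Poly_Mapping.single y 1) 1"

definition monomials :: "'v set \<Rightarrow> ('v, 'k::field) mpol set" where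
  "monomials V = {Poly_Mapping.single m 1 |m. Poly_Mapping.keys m \<subseteq> V}"

definition monomial_ideal :: "'v set \<Rightarrow> ('v, 'k::field) mpol set \<Rightarrow> bool" where
  "monomial_ideal V I \<longleftrightarrow> (\<exists>S\<subseteq>monomials V. I = Idl\<^bsub>poly_ring V\<^esub> S)"

definition is_min_monomial_gens ::
    "'v set \<Rightarrow> ('v, 'k::field) mpol set \<Rightarrow> ('v, 'k) mpol set \<Rightarrow> bool" where
  "is_min_monomial_gens V I S \<longleftrightarrow>
     S \<subseteq> monomials V \<and> Idl\<^bsub>poly_ring V\<^esub> S = I \<and> (\<forall>T. T \<subset> S \<longrightarrow> Idl\<^bsub>poly_ring V\<^esub> T \<noteq> I)"

text \<open>For a monomial ideal in finitely many indeterminates there is exactly one such set, so the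
  description below is meaningful; it is only used for such ideals.\<close>

definition min_monomial_gens ::
    "'v set \<Rightarrow> ('v, 'k::field) mpol set \<Rightarrow> ('v, 'k) mpol set" where
  "min_monomial_gens V I = (THE S. is_min_monomial_gens V I S)"

text \<open>Greatest common divisors are taken in the ring \<open>poly_ring V\<close>, where they are determined up to
  a unit; between monomials (which have coefficient 1) this leaves no ambiguity.\<close>

definition split_generator ::
    "'v set \<Rightarrow> ('v, 'k::field) mpol set \<Rightarrow> ('v, 'k) mpol \<Rightarrow> bool" where
  "split_generator V I u \<longleftrightarrow>
     monomial_ideal V I \<and> u \<in> min_monomial_gens V I \<and>
     (\<exists>w\<in>monomials V. \<exists>g\<in>monomials V.
        w \<noteq> 1 \<and> 1 gcdof\<^bsub>poly_ring V\<^esub> w g \<and> u = w * g \<and>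
        (\<forall>u'\<in>min_monomial_gens V I - {u}. w gcdof\<^bsub>poly_ring V\<^esub> u' u))"

definition separable :: "'v set \<Rightarrow> ('v, 'k::field) mpol set \<Rightarrow> bool" where
  "separable V I \<longleftrightarrow> monomial_ideal V I \<and> (\<exists>u. split_generator V I u)"

definition ideal_colon :: "('a, 'b) ring_scheme \<Rightarrow> 'a set \<Rightarrow> 'a set \<Rightarrow> 'a set" where
  "ideal_colon R I J = {a \<in> carrier R. \<forall>b\<in>J. a \<otimes>\<^bsub>R\<^esub> b \<in> I}"

definition strong_persistence :: "('a, 'b) ring_scheme \<Rightarrow> 'a set \<Rightarrow> bool" where
  "strong_persistence R I \<longleftrightarrow>
     (\<forall>k\<ge>1. ideal_colon R (I [^]\<^bsub>ideals_set R\<^esub> (k + 1 :: nat)) I = I [^]\<^bsub>ideals_set R\<^esub> k)"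

text \<open>Finite simple graphs are the library's \<^locale>\<open>graph\<close>: finite symmetric digraphs without loops
  and multiple arcs; an undirected edge is a pair of opposite arcs.\<close>

definition closed_nbhd :: "('v, 'e) pre_digraph \<Rightarrow> 'v \<Rightarrow> 'v set" where
  "closed_nbhd G y = {y} \<union> {z \<in> verts G. y \<rightarrow>\<^bsub>G\<^esub> z}"

definition CNI :: "('v, 'e) pre_digraph \<Rightarrow> ('v, 'k::field) mpol set" where
  "CNI G = Idl\<^bsub>poly_ring (verts G)\<^esub> {\<Prod>z\<in>closed_nbhd G y. indet z |y. y \<in> verts G}"

definition is_clique :: "('v, 'e) pre_digraph \<Rightarrow> 'v set \<Rightarrow> bool" where
  "is_clique G C \<longleftrightarrow> C \<subseteq> verts G \<and> (\<forall>x\<in>C. \<forall>y\<in>C. x \<noteq> y \<longrightarrow> x \<rightarrow>\<^bsub>G\<^esub> y)"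

end

theory Submission
  imports Defs
begin

text \<open>The closed neighborhoods of the members of \<open>C\<close> are the whole vertex set, that of \<open>v\<close> is
  \<open>C \<union> {v}\<close>, and that of a member of \<open>X\<close> contains \<open>C\<close> but not \<open>v\<close>. Hence \<open>u = x_C x_v\<close> divides
  the product of all indeterminates, and no generator other than \<open>u\<close> divides \<open>u\<close>. So \<open>u\<close> is a
  minimal generator, the other minimal ones come from \<open>X\<close>, and each of these meets \<open>u\<close> in exactly
  \<open>w = x_C\<close>. With the cofactor \<open>g = x_v\<close> this is the definition of a split generator. If \<open>X\<close> is
  empty, \<open>u\<close> is the only generator and the same \<open>w\<close> and \<open>g\<close> serve.

  Strong persistence holds for every separable ideal (\<open>separable_imp_strong_persistence\<close>).
  Let \<open>u = w g\<close> be the split generator and let \<open>m\<close> be a monomial with \<open>m u \<in> I^(k+1)\<close>; then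
  \<open>m u\<close> is a multiple of a product of \<open>k + 1\<close> generators. If \<open>u\<close> is one of the factors, cancel it.
  Otherwise every factor is a multiple of \<open>w\<close> and coprime to \<open>g\<close>. Drop one factor, which pays for
  the \<open>w\<close> in \<open>u\<close>, while \<open>g\<close> contributes nothing to being a multiple of the others. Either way \<open>m\<close>
  is a multiple of a product of \<open>k\<close> generators (\<open>split_exp_cancel\<close>).

  Everything is reduced to exponent vectors. The ideal generated by a set of monomials consists of
  the polynomials all of whose monomials are multiples of a generator (\<open>Idl_mono_of\<close>), so that
  products of ideals become sums of exponent sets (\<open>exp_ideal_prod\<close>) and the minimal monomial
  generators are those with minimal exponents (\<open>is_min_monomial_gens_minimal_exps\<close>,
  \<open>is_min_monomial_gens_eq\<close>). Greatest common divisors are taken among all polynomials, and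
  become coordinatewise minima because a divisor of a monomial is a monomial up to a scalar
  (\<open>factor_of_single\<close>, \<open>gcdof_mono_of_iff\<close>).\<close>

section \<open>Exponent vectors\<close>

abbreviation lookup :: "('a \<Rightarrow>\<^sub>0 'b::zero) \<Rightarrow> 'a \<Rightarrow> 'b" where
  "lookup \<equiv> Poly_Mapping.lookup"

abbreviation keys :: "('a \<Rightarrow>\<^sub>0 'b::zero) \<Rightarrow> 'a set" where
  "keys \<equiv> Poly_Mapping.keys"

abbreviation single :: "'a \<Rightarrow> 'b \<Rightarrow> ('a \<Rightarrow>\<^sub>0 'b::zero)" where
  "single \<equiv> Poly_Mapping.single"

definition le_exp :: "('v \<Rightarrow>\<^sub>0 nat) \<Rightarrow> ('v \<Rightarrow>\<^sub>0 nat) \<Rightarrow> bool" (infix "\<preceq>" 50) where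
  "e \<preceq> m \<longleftrightarrow> (\<forall>y. lookup e y \<le> lookup m y)"

definition minimal_exps :: "('v \<Rightarrow>\<^sub>0 nat) set \<Rightarrow> ('v \<Rightarrow>\<^sub>0 nat) set" where
  "minimal_exps E = {e \<in> E. \<forall>d\<in>E. d \<preceq> e \<longrightarrow> d = e}"

abbreviation mono_of :: "('v \<Rightarrow>\<^sub>0 nat) \<Rightarrow> ('v, 'k::field) mpol" where
  "mono_of e \<equiv> single e 1"

lemma le_exp_refl [simp, intro!]: "e \<preceq> e"
  by (simp add: le_exp_def)

lemma le_exp_trans: "d \<preceq> e \<Longrightarrow> e \<preceq> m \<Longrightarrow> d \<preceq> m"
  unfolding le_exp_def using order_trans by blast

lemma le_exp_antisym: "d \<preceq> e \<Longrightarrow> e \<preceq> d \<Longrightarrow> d = e"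
  by (rule poly_mapping_eqI) (auto simp: le_exp_def intro: antisym)

lemma le_exp_add_mono: "a \<preceq> m \<Longrightarrow> b \<preceq> n \<Longrightarrow> a + b \<preceq> m + n"
  by (auto simp: le_exp_def lookup_add intro: add_mono)

lemma le_exp_add_left [simp]: "e \<preceq> e + d"
  by (simp add: le_exp_def lookup_add)

lemma le_exp_add_right [simp]: "e \<preceq> d + e"
  by (simp add: le_exp_def lookup_add)

lemma le_exp_keys: "e \<preceq> m \<Longrightarrow> keys e \<subseteq> keys m"
  by (auto simp: le_exp_def in_keys_iff) (metis less_le_trans)

lemma le_exp_diff_add: "e \<preceq> m \<Longrightarrow> (m - e) + e = m"
  by (rule poly_mapping_eqI) (simp add: le_exp_def lookup_add lookup_minus)

lemma keys_exp_diff: "keys (m - e) \<subseteq> keys (m :: 'v \<Rightarrow>\<^sub>0 nat)"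
  by (auto simp: in_keys_iff lookup_minus)

text \<open>Total degree makes strict divisibility well-founded; the existence of minimal exponents rests on
  this.\<close>
lemma degree_strict_mono:
  assumes "d \<preceq> e" "d \<noteq> e"
  shows "sum (lookup d) (keys d) < sum (lookup e) (keys e)"
proof -
  have "sum (lookup d) (keys d) = sum (lookup d) (keys e)"
    using le_exp_keys[OF assms(1)] by (intro sum.mono_neutral_left) (auto simp: in_keys_iff)
  also have "\<dots> < sum (lookup e) (keys e)"
  proof (rule sum_strict_mono_ex1)
    show "\<forall>y\<in>keys e. lookup d y \<le> lookup e y"
      using assms(1) by (simp add: le_exp_def)
    obtain y where "lookup d y \<noteq> lookup e y"
      using assms(2) by (metis poly_mapping_eqI)
    with assms(1) have "lookup d y < lookup e y"
      by (simp add: le_exp_def le_neq_implies_less)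
    then show "\<exists>y\<in>keys e. lookup d y < lookup e y"
      by (intro bexI[of _ y]) (auto simp: in_keys_iff)
  qed simp
  finally show ?thesis .
qed

lemma minimal_exp_below:
  assumes "e \<in> E"
  shows "\<exists>d\<in>minimal_exps E. d \<preceq> e"
  using assms
proof (induction "sum (lookup e) (keys e)" arbitrary: e rule: less_induct)
  case less
  show ?case
  proof (cases "e \<in> minimal_exps E")
    case False
    then obtain d where d: "d \<in> E" "d \<preceq> e" "d \<noteq> e"
      using less.prems by (auto simp: minimal_exps_def)
    then show ?thesis
      using less.hyps[OF degree_strict_mono[OF d(2,3)] d(1)] le_exp_trans by blast
  qed blast
qed

section \<open>Monomial ideals\<close>

text \<open>For a set \<open>E\<close> of exponents in \<open>V\<close> this is the ideal generated by the monomials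
  with exponent in \<open>E\<close>, in a form in which membership is decided one monomial at a time.\<close>

definition exp_ideal :: "'v set \<Rightarrow> ('v \<Rightarrow>\<^sub>0 nat) set \<Rightarrow> ('v, 'k::field) mpol set" where
  "exp_ideal V E = {p \<in> carrier (poly_ring V). \<forall>m\<in>keys p. \<exists>e\<in>E. e \<preceq> m}"

lemma ring_poly_ring: "ring (poly_ring V)"
  using cring_poly_ring by (rule cring.axioms)

lemma in_carrier_poly_ring:
  "p \<in> carrier (poly_ring V) \<longleftrightarrow> (\<forall>m\<in>keys p. keys m \<subseteq> V)"
  by (simp add: poly_ring_def)

lemma poly_ring_simps [simp]:
  "monoid.mult (poly_ring V) = (*)" "one (poly_ring V) = 1"
  "zero (poly_ring V) = 0" "add (poly_ring V) = (+)"
  by (simp_all add: poly_ring_def)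

lemma monomials_eq: "monomials V = mono_of ` {e. keys e \<subseteq> V}"
  by (auto simp: monomials_def)

lemma single_eq_single_iff:
  "b \<noteq> 0 \<Longrightarrow> single d b = single e c \<longleftrightarrow> d = e \<and> b = c"
  by (metis lookup_single_eq lookup_single_not_eq)

lemma mono_of_eq_iff [simp]: "(mono_of d :: ('v, 'k::field) mpol) = mono_of e \<longleftrightarrow> d = e"
  by (simp add: single_eq_single_iff)

lemma mono_of_image_iff [simp]:
  "(mono_of e :: ('v, 'k::field) mpol) \<in> mono_of ` E \<longleftrightarrow> e \<in> E"
  by auto

lemma mono_of_in_monomials [simp]:
  "(mono_of e :: ('v, 'k::field) mpol) \<in> monomials V \<longleftrightarrow> keys e \<subseteq> V"
  by (simp add: monomials_eq)

lemma mono_of_mult: "mono_of d * mono_of e = (mono_of (d + e) :: ('v, 'k::field) mpol)"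
  by (simp add: mult_single)

lemma single_in_carrier:
  "keys m \<subseteq> V \<Longrightarrow> single m c \<in> carrier (poly_ring V)"
  by (simp add: in_carrier_poly_ring)

lemma mono_of_in_exp_ideal:
  "(mono_of m :: ('v, 'k::field) mpol) \<in> exp_ideal V E \<longleftrightarrow>
     keys m \<subseteq> V \<and> (\<exists>e\<in>E. e \<preceq> m)"
  by (auto simp: exp_ideal_def in_carrier_poly_ring)

lemma poly_ring_a_inv:
  fixes p :: "('v, 'k::field) mpol"
  assumes "p \<in> carrier (poly_ring V)"
  shows "inv\<^bsub>add_monoid (poly_ring V)\<^esub> p = - p"
proof -
  interpret ring "poly_ring V :: ('v, 'k) mpol ring" by (rule ring_poly_ring)
  show ?thesis
    by (rule group.inv_equality[OF a_group]) (use assms in \<open>auto simp: in_carrier_poly_ring\<close>)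
qed

lemma exp_ideal_is_ideal: "ideal (exp_ideal V E :: ('v, 'k::field) mpol set) (poly_ring V)"
proof -
  let ?R = "poly_ring V :: ('v, 'k) mpol ring"
  interpret cring ?R by (rule cring_poly_ring)
  have absorb: "p * q \<in> exp_ideal V E"
    if p: "p \<in> exp_ideal V E" and q: "q \<in> carrier ?R" for p q :: "('v, 'k) mpol"
  proof -
    have "p * q \<in> carrier ?R"
      using m_closed[of p q] p q by (simp add: exp_ideal_def)
    moreover have "\<exists>e\<in>E. e \<preceq> m" if m: "m \<in> keys (p * q)" for m
    proof -
      obtain a b where m: "m = a + b" "a \<in> keys p"
        using m keys_mult[of p q] by blast
      obtain e where "e \<in> E" "e \<preceq> a" using p m(2) by (auto simp: exp_ideal_def)
      then show ?thesis using m(1) le_exp_trans[OF _ le_exp_add_left] by blast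
    qed
    ultimately show ?thesis by (simp add: exp_ideal_def)
  qed
  show ?thesis
  proof (rule idealI)
    show "ring ?R" by (rule ring_poly_ring)
    show "subgroup (exp_ideal V E) (add_monoid ?R)"
    proof
      show "x \<otimes>\<^bsub>add_monoid ?R\<^esub> y \<in> exp_ideal V E"
        if "x \<in> exp_ideal V E" "y \<in> exp_ideal V E" for x y
        using that keys_add[of x y] by (fastforce simp: exp_ideal_def in_carrier_poly_ring)
      show "inv\<^bsub>add_monoid ?R\<^esub> x \<in> exp_ideal V E" if "x \<in> exp_ideal V E" for x
        using that poly_ring_a_inv[of x V] by (simp add: exp_ideal_def in_carrier_poly_ring)
    qed (auto simp: exp_ideal_def in_carrier_poly_ring)
    show "x \<otimes>\<^bsub>?R\<^esub> a \<in> exp_ideal V E" if "a \<in> exp_ideal V E" "x \<in> carrier ?R" for a x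
      using absorb[OF that] by (simp add: mult.commute)
    show "a \<otimes>\<^bsub>?R\<^esub> x \<in> exp_ideal V E" if "a \<in> exp_ideal V E" "x \<in> carrier ?R" for a x
      using absorb[OF that] by simp
  qed
qed

text \<open>A polynomial is the sum of its terms, and each of its terms is a multiple of some \<open>mono_of e\<close>.\<close>
lemma exp_ideal_minimal:
  fixes J :: "('v, 'k::field) mpol set"
  assumes J: "ideal J (poly_ring V)"
    and E: "\<And>e. e \<in> E \<Longrightarrow> mono_of e \<in> J"
  shows "exp_ideal V E \<subseteq> J"
proof
  fix p :: "('v, 'k) mpol" assume p: "p \<in> exp_ideal V E"
  interpret ideal J "poly_ring V" by (rule J)
  have Jadd: "a + b \<in> J" if "a \<in> J" "b \<in> J" for a b
    using additive_subgroup.a_closed[OF ideal.axioms(1)[OF J], of a b] that by simp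
  have term_in: "single m (lookup p m) \<in> J" if m: "m \<in> keys p" for m
  proof -
    obtain e where e: "e \<in> E" "e \<preceq> m" using p m by (auto simp: exp_ideal_def)
    have "keys (m - e) \<subseteq> V"
      using p m keys_exp_diff[of m e] by (fastforce simp: exp_ideal_def in_carrier_poly_ring)
    then have "single (m - e) (lookup p m) * mono_of e \<in> J"
      using I_l_closed[OF E[OF e(1)], of "single (m - e) (lookup p m)"]
      by (simp add: single_in_carrier)
    then show ?thesis by (simp add: mult_single le_exp_diff_add[OF e(2)])
  qed
  have "(\<Sum>m\<in>A. single m (lookup p m)) \<in> J"
    if "finite A" "A \<subseteq> keys p" for A
    using that
  proof (induction rule: finite_induct)
    case empty
    show ?case using additive_subgroup.zero_closed[OF ideal.axioms(1)[OF J]] by simp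
  next
    case (insert m A)
    then show ?case using Jadd[OF term_in] by simp
  qed
  moreover have "(\<Sum>m\<in>keys p. single m (lookup p m)) = p"
    by (rule poly_mapping_eqI)
      (auto simp: lookup_sum lookup_single when_def in_keys_iff sum.delta')
  ultimately show "p \<in> J" by (metis finite_keys order_refl)
qed

lemma Idl_mono_of:
  assumes "\<And>e. e \<in> E \<Longrightarrow> keys e \<subseteq> V"
  shows "Idl\<^bsub>poly_ring V\<^esub> (mono_of ` E) = (exp_ideal V E :: ('v, 'k::field) mpol set)"
proof -
  interpret ring "poly_ring V :: ('v, 'k) mpol ring" by (rule ring_poly_ring)
  have sub: "(mono_of ` E :: ('v, 'k) mpol set) \<subseteq> carrier (poly_ring V)"
    using assms by (auto intro: single_in_carrier)
  show ?thesis
  proof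
    show "Idl\<^bsub>poly_ring V\<^esub> (mono_of ` E) \<subseteq> (exp_ideal V E :: ('v, 'k) mpol set)"
      using assms by (intro genideal_minimal exp_ideal_is_ideal) (auto simp: mono_of_in_exp_ideal)
    show "(exp_ideal V E :: ('v, 'k) mpol set) \<subseteq> Idl\<^bsub>poly_ring V\<^esub> (mono_of ` E)"
      using genideal_self[OF sub] by (intro exp_ideal_minimal genideal_ideal[OF sub]) auto
  qed
qed

lemma exp_ideal_cong:
  assumes "\<And>e. e \<in> E \<Longrightarrow> \<exists>d\<in>F. d \<preceq> e" "\<And>e. e \<in> F \<Longrightarrow> \<exists>d\<in>E. d \<preceq> e"
  shows "exp_ideal V E = exp_ideal V F"
  unfolding exp_ideal_def using assms le_exp_trans by (metis (no_types, lifting))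

section \<open>Minimal monomial generators\<close>

text \<open>An exponent that is minimal in \<open>E\<close> has no other member of \<open>E\<close> below it, so its monomial is not
  in the ideal of the remaining ones.\<close>
lemma is_min_monomial_gens_minimal_exps:
  assumes E: "\<And>e. e \<in> E \<Longrightarrow> keys e \<subseteq> V"
  shows "is_min_monomial_gens V (Idl\<^bsub>poly_ring V\<^esub> (mono_of ` E))
           (mono_of ` minimal_exps E :: ('v, 'k::field) mpol set)"
proof -
  have M: "minimal_exps E \<subseteq> E" by (auto simp: minimal_exps_def)
  have "(exp_ideal V (minimal_exps E) :: ('v, 'k) mpol set) = exp_ideal V E"
    using M minimal_exp_below[of _ E] by (intro exp_ideal_cong) (auto intro: le_exp_refl)
  then have gen: "Idl\<^bsub>poly_ring V\<^esub> (mono_of ` minimal_exps E :: ('v, 'k) mpol set)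
      = Idl\<^bsub>poly_ring V\<^esub> (mono_of ` E)"
    using E M by (subst (1 2) Idl_mono_of) auto
  have "Idl\<^bsub>poly_ring V\<^esub> T \<noteq> Idl\<^bsub>poly_ring V\<^esub> (mono_of ` E)"
    if T: "T \<subset> (mono_of ` minimal_exps E :: ('v, 'k) mpol set)" for T
  proof
    assume eq: "Idl\<^bsub>poly_ring V\<^esub> T = Idl\<^bsub>poly_ring V\<^esub> (mono_of ` E)"
    obtain F where F: "F \<subseteq> minimal_exps E" "T = mono_of ` F"
      using T by (metis psubset_imp_subset subset_imageE)
    obtain e where e: "e \<in> minimal_exps E" "e \<notin> F" using T F by auto
    have "mono_of e \<in> (exp_ideal V E :: ('v, 'k) mpol set)"
      using e M E by (auto simp: mono_of_in_exp_ideal)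
    also have "(exp_ideal V E :: ('v, 'k) mpol set) = exp_ideal V F"
      using eq Idl_mono_of[of E V, OF E, where 'k='k] Idl_mono_of[of F V, where 'k='k] E F M by blast
    finally obtain d where "d \<in> F" "d \<preceq> e" by (auto simp: mono_of_in_exp_ideal)
    then show False using e F M by (auto simp: minimal_exps_def)
  qed
  then show ?thesis
    using gen M E by (auto simp: is_min_monomial_gens_def monomials_eq)
qed

text \<open>The right-hand side depends on \<open>I\<close> alone, which gives the uniqueness of minimal monomial
  generators. In an irredundant generating set no exponent lies below another one, since the larger
  one could be omitted.\<close>
lemma is_min_monomial_gens_eq:
  assumes "is_min_monomial_gens V I (S :: ('v, 'k::field) mpol set)"
  shows "S = mono_of ` minimal_exps {e. mono_of e \<in> I}"
proof -
  obtain E where E: "\<And>e. e \<in> E \<Longrightarrow> keys e \<subseteq> V" and S: "S = mono_of ` E"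
    using assms by (auto simp: is_min_monomial_gens_def monomials_eq subset_image_iff)
  have I: "I = exp_ideal V E"
    using assms Idl_mono_of[OF E] by (auto simp: is_min_monomial_gens_def S)
  have ne: "exp_ideal V (E - {e}) \<noteq> I" if "e \<in> E" for e
  proof -
    have "mono_of ` (E - {e}) \<subset> S"
      using that by (auto simp: S psubset_eq) (metis Diff_iff insertI1 mono_of_image_iff)
    then have "Idl\<^bsub>poly_ring V\<^esub> (mono_of ` (E - {e})) \<noteq> I"
      using assms by (auto simp: is_min_monomial_gens_def)
    then show ?thesis using E Idl_mono_of[of "E - {e}" V, where 'k='k] by auto
  qed
  have anti: "d = e" if "d \<in> E" "e \<in> E" "d \<preceq> e" for d e
  proof (rule ccontr)
    assume "d \<noteq> e"
    with that have "(exp_ideal V (E - {e}) :: ('v, 'k) mpol set) = exp_ideal V E"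
      by (intro exp_ideal_cong) (auto intro: le_exp_refl)
    then show False using ne[OF that(2)] I by simp
  qed
  let ?M = "{e. (mono_of e :: ('v, 'k) mpol) \<in> I}"
  have M: "?M = {m. keys m \<subseteq> V \<and> (\<exists>e\<in>E. e \<preceq> m)}"
    by (simp add: I mono_of_in_exp_ideal)
  have "E = minimal_exps ?M"
  proof
    show "minimal_exps ?M \<subseteq> E"
    proof
      fix x assume x: "x \<in> minimal_exps ?M"
      then obtain e where e: "e \<in> E" "e \<preceq> x" unfolding M minimal_exps_def by blast
      then have "e \<in> ?M" using E unfolding M by blast
      then show "x \<in> E" using x e unfolding minimal_exps_def by blast
    qed
    show "E \<subseteq> minimal_exps ?M"
      using E anti unfolding M minimal_exps_def
      by (auto intro: le_exp_refl) (metis le_exp_antisym le_exp_trans)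
  qed
  then show ?thesis using S by simp
qed

lemma min_monomial_gens_eqI:
  assumes "is_min_monomial_gens V I S"
  shows "min_monomial_gens V I = S"
  unfolding min_monomial_gens_def
  using assms by (rule the_equality) (use assms in \<open>metis is_min_monomial_gens_eq\<close>)

section \<open>Divisors of monomials\<close>

text \<open>A monomial that arises from only one pair of terms cannot be cancelled in the product.\<close>
lemma add_in_keys_mult:
  fixes p q :: "'a::cancel_comm_monoid_add \<Rightarrow>\<^sub>0 'k::field"
  assumes a: "a \<in> keys p" and b: "b \<in> keys q"
    and uniq: "\<And>a' b'. \<lbrakk>a' \<in> keys p; b' \<in> keys q; a' + b' = a + b\<rbrakk>
                 \<Longrightarrow> a' = a \<and> b' = b"
  shows "a + b \<in> keys (p * q)"
proof -
  define p' where "p' = p - single a (lookup p a)"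
  define q' where "q' = q - single b (lookup q b)"
  have p: "p = single a (lookup p a) + p'" by (simp add: p'_def)
  have q: "q = single b (lookup q b) + q'" by (simp add: q'_def)
  have kp: "keys p' = keys p - {a}"
    by (auto simp: p'_def in_keys_iff lookup_minus lookup_single when_def split: if_splits)
  have kq: "keys q' = keys q - {b}"
    by (auto simp: q'_def in_keys_iff lookup_minus lookup_single when_def split: if_splits)
  have "a + b \<notin> keys (p' * q)"
    using keys_mult[of p' q] uniq kp by fastforce
  moreover have "a + b \<notin> keys (single a (lookup p a) * q')"
    using keys_mult[of "single a (lookup p a)" q'] kq by (auto split: if_splits)
  moreover have "p * q = single (a + b) (lookup p a * lookup q b)
      + single a (lookup p a) * q' + p' * q"
  proof -
    have "p * q = single a (lookup p a) * q + p' * q"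
      using p by (metis distrib_right)
    also have "single a (lookup p a) * q
        = single (a + b) (lookup p a * lookup q b)
          + single a (lookup p a) * q'"
      using q by (metis distrib_left mult_single)
    finally show ?thesis .
  qed
  ultimately have "lookup (p * q) (a + b) = lookup p a * lookup q b"
    by (simp add: lookup_add in_keys_iff)
  then show ?thesis using a b by (simp add: in_keys_iff)
qed

text \<open>Exponent vectors indexed by natural numbers carry a linear order that is compatible with
  addition. Pulling it back along an enumeration of \<open>U\<close> gives a monomial order on exponents in \<open>U\<close>
  although the index type itself is not ordered.\<close>
lemma ex_additive_order_embedding:
  assumes "finite U"
  shows "\<exists>\<phi> :: ('v \<Rightarrow>\<^sub>0 nat) \<Rightarrow> (nat \<Rightarrow>\<^sub>0 nat).
    (\<forall>a b. \<phi> (a + b) = \<phi> a + \<phi> b) \<and> inj_on \<phi> {a. keys a \<subseteq> U}"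
proof -
  obtain \<iota> :: "'v \<Rightarrow> nat" where \<iota>: "inj_on \<iota> U"
    using finite_imp_inj_to_nat_seg[OF assms] by blast
  define \<phi> where "\<phi> a = (\<Sum>y\<in>U. single (\<iota> y) (lookup a y))" for a :: "'v \<Rightarrow>\<^sub>0 nat"
  have "\<phi> (a + b) = \<phi> a + \<phi> b" for a b
    by (simp add: \<phi>_def lookup_add single_add sum.distrib)
  moreover have "inj_on \<phi> {a. keys a \<subseteq> U}"
  proof (rule inj_onI)
    fix a b assume ab: "a \<in> {a. keys a \<subseteq> U}" "b \<in> {a. keys a \<subseteq> U}"
      and eq: "\<phi> a = \<phi> b"
    have look: "lookup (\<phi> c) (\<iota> y) = lookup c y" if "y \<in> U" for c y
    proof -
      have "lookup (\<phi> c) (\<iota> y) = (\<Sum>z\<in>U. if z = y then lookup c z else 0)"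
        using \<iota> that
        by (auto simp: \<phi>_def lookup_sum lookup_single when_def inj_on_eq_iff intro!: sum.cong)
      also have "\<dots> = lookup c y" using that assms by simp
      finally show ?thesis .
    qed
    show "a = b"
    proof (rule poly_mapping_eqI)
      fix y
      show "lookup a y = lookup b y"
      proof (cases "y \<in> U")
        case True
        then show ?thesis using look eq by metis
      next
        case False
        then have "y \<notin> keys a" "y \<notin> keys b" using ab by auto
        then show ?thesis by (simp add: in_keys_iff)
      qed
    qed
  qed
  ultimately show ?thesis by (intro exI[of _ \<phi>]) blast
qed

lemma add_eq_mono_imp_eq:
  fixes x x' :: "'a::linordered_cancel_ab_semigroup_add"
  assumes "x \<le> x'" "y \<le> y'" "x + y = x' + y'"
  shows "x = x' \<and> y = y'"
  using assms by (metis add_le_less_mono add_less_le_mono order_less_irrefl order_le_less)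

text \<open>For a monomial order, the product of the leading terms of \<open>p\<close> and \<open>q\<close> and the product of their
  lowest terms both survive in \<open>p * q\<close>. If the product has only one term, these two coincide, which
  forces the leading and the lowest monomial of \<open>p\<close> to be equal.\<close>
lemma factor_of_single:
  fixes p q :: "('v, 'k::field) mpol"
  assumes pq: "p * q = single m c" and c: "c \<noteq> 0"
  shows "\<exists>d b. p = single d b \<and> b \<noteq> 0 \<and> d \<preceq> m"
proof -
  have "p * q \<noteq> 0" using pq c by (metis lookup_single_eq lookup_zero)
  then have nz: "keys p \<noteq> {}" "keys q \<noteq> {}" by auto
  have only: "x = m" if "x \<in> keys (p * q)" for x
    using that c by (simp add: pq)
  define U where "U = \<Union> (keys ` (keys p \<union> keys q))"
  have U: "finite U" by (simp add: U_def)
  obtain \<phi> :: "('v \<Rightarrow>\<^sub>0 nat) \<Rightarrow> (nat \<Rightarrow>\<^sub>0 nat)" where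
    add: "\<And>a b. \<phi> (a + b) = \<phi> a + \<phi> b" and inj: "inj_on \<phi> {a. keys a \<subseteq> U}"
    using ex_additive_order_embedding[OF U] by blast
  have inj': "a = b" if "\<phi> a = \<phi> b" "a \<in> keys p \<union> keys q"
    "b \<in> keys p \<union> keys q" for a b
    using that inj_onD[OF inj that(1)] by (auto simp: U_def)
  have ext: "(\<exists>a\<in>A. \<forall>x\<in>A. \<phi> x \<le> \<phi> a) \<and> (\<exists>a\<in>A. \<forall>x\<in>A. \<phi> a \<le> \<phi> x)"
    if "finite A" "A \<noteq> {}" for A
  proof
    have "Max (\<phi> ` A) \<in> \<phi> ` A" "Min (\<phi> ` A) \<in> \<phi> ` A" using that by simp_all
    then obtain a b where "a \<in> A" "\<phi> a = Max (\<phi> ` A)" "b \<in> A" "\<phi> b = Min (\<phi> ` A)"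
      by fastforce
    then show "\<exists>a\<in>A. \<forall>x\<in>A. \<phi> x \<le> \<phi> a" "\<exists>a\<in>A. \<forall>x\<in>A. \<phi> a \<le> \<phi> x"
      using that by (metis Max_ge finite_imageI imageI, metis Min_le finite_imageI imageI)
  qed
  \<comment> \<open>Leading monomials \<open>a1\<close>, \<open>b1\<close> and lowest monomials \<open>a0\<close>, \<open>b0\<close> of \<open>p\<close> and \<open>q\<close>.\<close>
  obtain a1 where a1: "a1 \<in> keys p" "\<And>a. a \<in> keys p \<Longrightarrow> \<phi> a \<le> \<phi> a1"
    using ext[of "keys p"] nz by auto
  obtain b1 where b1: "b1 \<in> keys q" "\<And>b. b \<in> keys q \<Longrightarrow> \<phi> b \<le> \<phi> b1"
    using ext[of "keys q"] nz by auto
  obtain a0 where a0: "a0 \<in> keys p" "\<And>a. a \<in> keys p \<Longrightarrow> \<phi> a0 \<le> \<phi> a"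
    using ext[of "keys p"] nz by auto
  obtain b0 where b0: "b0 \<in> keys q" "\<And>b. b \<in> keys q \<Longrightarrow> \<phi> b0 \<le> \<phi> b"
    using ext[of "keys q"] nz by auto
  have "a1 + b1 = m"
  proof (rule only, rule add_in_keys_mult[OF a1(1) b1(1)])
    fix a b assume ab: "a \<in> keys p" "b \<in> keys q" "a + b = a1 + b1"
    then have "\<phi> a = \<phi> a1 \<and> \<phi> b = \<phi> b1"
      using add_eq_mono_imp_eq[OF a1(2)[OF ab(1)] b1(2)[OF ab(2)]] by (metis add)
    then show "a = a1 \<and> b = b1" using inj' ab a1(1) b1(1) by blast
  qed
  moreover have "a0 + b0 = m"
  proof (rule only, rule add_in_keys_mult[OF a0(1) b0(1)])
    fix a b assume ab: "a \<in> keys p" "b \<in> keys q" "a + b = a0 + b0"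
    then have "\<phi> a0 = \<phi> a \<and> \<phi> b0 = \<phi> b"
      using add_eq_mono_imp_eq[OF a0(2)[OF ab(1)] b0(2)[OF ab(2)]] by (metis add)
    then show "a = a0 \<and> b = b0" using inj' ab a0(1) b0(1) by blast
  qed
  ultimately have "\<phi> a0 = \<phi> a1"
    using add_eq_mono_imp_eq[OF a0(2)[OF a1(1)] b0(2)[OF b1(1)]] by (metis add)
  then have "a = a1" if "a \<in> keys p" for a
    using inj'[of a a1] a0(2)[OF that] a1(1) a1(2)[OF that] that by auto
  then have "keys p = {a1}" using a1(1) by blast
  then have "p = single a1 (lookup p a1)"
    by (intro poly_mapping_eqI) (auto simp: lookup_single when_def in_keys_iff)
  moreover have "a1 \<preceq> m" using \<open>a1 + b1 = m\<close> by auto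
  ultimately show ?thesis using a1(1) by (metis in_keys_iff)
qed

lemma divides_mono_of_iff:
  assumes p: "p \<in> carrier (poly_ring V)" and m: "keys m \<subseteq> V"
  shows "p divides\<^bsub>poly_ring V\<^esub> (mono_of m :: ('v, 'k::field) mpol) \<longleftrightarrow>
    (\<exists>d c. p = single d c \<and> c \<noteq> 0 \<and> d \<preceq> m)"
proof
  assume "p divides\<^bsub>poly_ring V\<^esub> (mono_of m :: ('v, 'k::field) mpol)"
  then obtain q where "p * q = mono_of m" by (auto simp: factor_def)
  then show "\<exists>d c. p = single d c \<and> c \<noteq> 0 \<and> d \<preceq> m"
    by (rule factor_of_single) simp
next
  assume "\<exists>d c. p = single d c \<and> c \<noteq> 0 \<and> d \<preceq> m"
  then obtain d c where d: "p = single d c" "c \<noteq> 0" "d \<preceq> m" by blast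
  have "mono_of m = p * single (m - d) (inverse c)"
    using d le_exp_diff_add[OF d(3)] by (simp add: mult_single add.commute)
  moreover have "single (m - d) (inverse c) \<in> carrier (poly_ring V)"
    using m keys_exp_diff[of m d] by (intro single_in_carrier) auto
  ultimately show "p divides\<^bsub>poly_ring V\<^esub> (mono_of m :: ('v, 'k::field) mpol)"
    by (auto simp: factor_def)
qed

lemma mono_of_divides_iff:
  assumes "keys d \<subseteq> V" "keys m \<subseteq> V"
  shows "mono_of d divides\<^bsub>poly_ring V\<^esub> (mono_of m :: ('v, 'k::field) mpol) \<longleftrightarrow> d \<preceq> m"
  using divides_mono_of_iff[OF single_in_carrier[OF assms(1)] assms(2), where 'k='k]
  by (auto simp: single_eq_single_iff)

lemma gcdof_mono_of_iff:
  assumes w: "keys w \<subseteq> V" and s: "keys s \<subseteq> V"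
    and u: "keys u \<subseteq> V"
  shows "(mono_of w :: ('v, 'k::field) mpol) gcdof\<^bsub>poly_ring V\<^esub> (mono_of s) (mono_of u) \<longleftrightarrow>
    (\<forall>y. lookup w y = min (lookup s y) (lookup u y))"
proof
  assume g: "(mono_of w :: ('v, 'k) mpol) gcdof\<^bsub>poly_ring V\<^esub> (mono_of s) (mono_of u)"
  \<comment> \<open>With truncated subtraction this is the coordinatewise minimum.\<close>
  define d where "d = s - (s - u)"
  have d: "lookup d y = min (lookup s y) (lookup u y)" for y
    by (simp add: d_def lookup_minus)
  have kd: "keys d \<subseteq> V"
    using s keys_exp_diff[of s "s - u"] by (auto simp: d_def)
  have "w \<preceq> s" "w \<preceq> u"
    using g w s u by (auto simp: isgcd_def mono_of_divides_iff)
  moreover have "d \<preceq> w"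
  proof -
    have "mono_of d divides\<^bsub>poly_ring V\<^esub> (mono_of s :: ('v, 'k) mpol)"
      "mono_of d divides\<^bsub>poly_ring V\<^esub> (mono_of u :: ('v, 'k) mpol)"
      using kd s u by (simp_all add: mono_of_divides_iff d le_exp_def)
    then have "mono_of d divides\<^bsub>poly_ring V\<^esub> (mono_of w :: ('v, 'k) mpol)"
      using g kd by (auto simp: isgcd_def single_in_carrier)
    then show ?thesis using kd w by (simp add: mono_of_divides_iff)
  qed
  ultimately show "\<forall>y. lookup w y = min (lookup s y) (lookup u y)"
    using d by (auto simp: le_exp_def intro: antisym)
next
  assume eq: "\<forall>y. lookup w y = min (lookup s y) (lookup u y)"
  then have "w \<preceq> s" "w \<preceq> u" by (simp_all add: le_exp_def)
  moreover have "d \<preceq> w" if "d \<preceq> s" "d \<preceq> u" for d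
    using that eq by (simp add: le_exp_def)
  ultimately show "(mono_of w :: ('v, 'k) mpol) gcdof\<^bsub>poly_ring V\<^esub> (mono_of s) (mono_of u)"
    using w s u unfolding isgcd_def
    by (auto simp: divides_mono_of_iff single_in_carrier single_eq_single_iff)
qed

section \<open>Split generators in terms of exponents\<close>

text \<open>The defining condition of a split generator \<open>w * g\<close>, read off the exponents of \<open>w\<close>, \<open>g\<close> and of
  the minimal generators.\<close>
definition split_exp :: "('v \<Rightarrow>\<^sub>0 nat) set \<Rightarrow> ('v \<Rightarrow>\<^sub>0 nat) \<Rightarrow> bool" where
  "split_exp E u \<longleftrightarrow> u \<in> E \<and>
     (\<exists>w g. w \<noteq> 0 \<and> (\<forall>y. min (lookup w y) (lookup g y) = 0) \<and> u = w + g \<and>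
        (\<forall>s\<in>E - {u}. \<forall>y. min (lookup s y) (lookup u y) = lookup w y))"

lemma split_generator_iff:
  assumes min: "is_min_monomial_gens V I (mono_of ` E :: ('v, 'k::field) mpol set)"
  shows "split_generator V I p \<longleftrightarrow> (\<exists>u. p = mono_of u \<and> split_exp E u)"
proof -
  have E: "keys e \<subseteq> V" if "e \<in> E" for e
    using min that mono_of_in_monomials[of e V] by (metis image_subset_iff is_min_monomial_gens_def)
  have mi: "monomial_ideal V I"
    using min by (auto simp: is_min_monomial_gens_def monomial_ideal_def)
  have gens: "min_monomial_gens V I = mono_of ` E"
    using min by (rule min_monomial_gens_eqI)
  have "split_generator V I (mono_of u) \<longleftrightarrow> split_exp E u" if u: "u \<in> E" for u
  proof -
    have diff: "mono_of ` E - {mono_of u :: ('v, 'k) mpol} = mono_of ` (E - {u})" by auto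
    have kw: "keys w \<subseteq> V" "keys g \<subseteq> V" if "u = w + g" for w g
      using E[OF u] le_exp_keys[of w u] le_exp_keys[of g u] that by auto
    have cop: "1 gcdof\<^bsub>poly_ring V\<^esub> (mono_of w) (mono_of g :: ('v, 'k) mpol)
        \<longleftrightarrow> (\<forall>y. min (lookup w y) (lookup g y) = 0)" if "u = w + g" for w g
      using gcdof_mono_of_iff[of 0 V w g, where 'k='k] kw[OF that] by auto
    have meet: "mono_of w gcdof\<^bsub>poly_ring V\<^esub> (mono_of s) (mono_of u :: ('v, 'k) mpol)
        \<longleftrightarrow> (\<forall>y. min (lookup s y) (lookup u y) = lookup w y)"
      if "u = w + g" "s \<in> E - {u}" for w g s
      using gcdof_mono_of_iff[of w V s u, where 'k='k] kw[OF that(1)] E u that(2) by auto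
    have one: "(mono_of w :: ('v, 'k) mpol) \<noteq> 1 \<longleftrightarrow> w \<noteq> 0" for w
      using mono_of_eq_iff[of w 0, where 'k='k] by simp
    show ?thesis
      unfolding split_generator_def split_exp_def gens diff monomials_eq
      using mi u kw by (auto simp: mono_of_mult one cop meet) (metis cop meet DiffI singletonD)+
  qed
  moreover have "split_generator V I p \<Longrightarrow> p \<in> mono_of ` E"
    by (simp add: split_generator_def gens)
  ultimately show ?thesis by (auto simp: split_exp_def)
qed

section \<open>Powers of monomial ideals\<close>

primrec exp_pow :: "('v \<Rightarrow>\<^sub>0 nat) set \<Rightarrow> nat \<Rightarrow> ('v \<Rightarrow>\<^sub>0 nat) set" where
  "exp_pow E 0 = {0}"
| "exp_pow E (Suc k) = {a + b |a b. a \<in> exp_pow E k \<and> b \<in> E}"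

lemma exp_ideal_prod:
  assumes E: "\<And>e. e \<in> E \<Longrightarrow> keys e \<subseteq> V"
    and F: "\<And>e. e \<in> F \<Longrightarrow> keys e \<subseteq> V"
  shows "ideal_prod (poly_ring V) (exp_ideal V E) (exp_ideal V F)
    = (exp_ideal V {a + b |a b. a \<in> E \<and> b \<in> F} :: ('v, 'k::field) mpol set)"
proof
  interpret ring "poly_ring V :: ('v, 'k) mpol ring" by (rule ring_poly_ring)
  let ?P = "exp_ideal V {a + b |a b. a \<in> E \<and> b \<in> F} :: ('v, 'k) mpol set"
  show "ideal_prod (poly_ring V) (exp_ideal V E) (exp_ideal V F) \<subseteq> ?P"
  proof
    fix p :: "('v, 'k) mpol"
    assume "p \<in> ideal_prod (poly_ring V) (exp_ideal V E) (exp_ideal V F)"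
    then show "p \<in> ?P"
    proof induction
      case (prod p q)
      have "p * q \<in> carrier (poly_ring V)"
        using m_closed[of p q] prod by (simp add: exp_ideal_def)
      moreover have "\<exists>e\<in>{a + b |a b. a \<in> E \<and> b \<in> F}. e \<preceq> m"
        if m: "m \<in> keys (p * q)" for m
      proof -
        obtain a b where ab: "m = a + b" "a \<in> keys p" "b \<in> keys q"
          using m keys_mult[of p q] by blast
        then obtain d e where "d \<in> E" "d \<preceq> a" "e \<in> F" "e \<preceq> b"
          using prod unfolding exp_ideal_def by blast
        then show ?thesis using le_exp_add_mono ab(1) by blast
      qed
      ultimately show ?case by (simp add: exp_ideal_def)
    next
      case (sum p q)
      then show ?case using additive_subgroup.a_closed[OF ideal.axioms(1)[OF exp_ideal_is_ideal]]
        by fastforce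
    qed
  qed
  have "mono_of e \<in> ideal_prod (poly_ring V) (exp_ideal V E :: ('v, 'k) mpol set) (exp_ideal V F)"
    if e: "e \<in> {a + b |a b. a \<in> E \<and> b \<in> F}" for e
  proof -
    obtain a b where ab: "e = a + b" "a \<in> E" "b \<in> F" using e by blast
    then have "mono_of a \<in> (exp_ideal V E :: ('v, 'k) mpol set)"
      "mono_of b \<in> (exp_ideal V F :: ('v, 'k) mpol set)"
      using E F by (auto simp: mono_of_in_exp_ideal)
    from ideal_prod.prod[OF this, of "poly_ring V"] show ?thesis
      by (simp add: mono_of_mult ab(1))
  qed
  then show "?P \<subseteq> ideal_prod (poly_ring V) (exp_ideal V E) (exp_ideal V F)"
    by (intro exp_ideal_minimal ideal_prod_is_ideal exp_ideal_is_ideal)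
qed

lemma keys_exp_pow:
  assumes "\<And>e. e \<in> E \<Longrightarrow> keys e \<subseteq> V"
  shows "e \<in> exp_pow E k \<Longrightarrow> keys e \<subseteq> V"
proof (induction k arbitrary: e)
  case (Suc k)
  then obtain a b where "e = a + b" "a \<in> exp_pow E k" "b \<in> E" by auto
  then show ?case using Suc.IH[of a] assms[of b] keys_add[of a b] by auto
qed simp

lemma exp_ideal_pow:
  assumes E: "\<And>e. e \<in> E \<Longrightarrow> keys e \<subseteq> V"
  shows "exp_ideal V E [^]\<^bsub>ideals_set (poly_ring V)\<^esub> (k :: nat)
    = (exp_ideal V (exp_pow E k) :: ('v, 'k::field) mpol set)"
proof (induction k)
  case 0
  have "0 \<preceq> m" for m :: "'v \<Rightarrow>\<^sub>0 nat" by (simp add: le_exp_def)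
  then show ?case by (auto simp: nat_pow_def ideals_set_def exp_ideal_def)
next
  case (Suc k)
  then show ?case
    using exp_ideal_prod[of "exp_pow E k" V E, OF keys_exp_pow[OF E] E, where 'k='k]
    by (simp add: nat_pow_def ideals_set_def)
qed

section \<open>Separable ideals are strongly persistent\<close>

lemma exp_pow_Suc_cases:
  assumes "e \<in> exp_pow E (Suc k)"
  shows "(\<exists>d\<in>exp_pow E k. e = d + u) \<or> e \<in> exp_pow (E - {u}) (Suc k)"
  using assms
proof (induction k arbitrary: e)
  case (Suc k)
  obtain a b where e: "e = a + b" "a \<in> exp_pow E (Suc k)" "b \<in> E"
    using Suc.prems by (subst (asm) exp_pow.simps) blast
  show ?case
  proof (cases "b = u")
    case True
    then show ?thesis using e by blast
  next
    case False
    from Suc.IH[OF e(2)] show ?thesis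
    proof
      assume "\<exists>d\<in>exp_pow E k. a = d + u"
      then obtain d where "d \<in> exp_pow E k" "a = d + u" by blast
      then have "d + b \<in> exp_pow E (Suc k)" "e = (d + b) + u"
        using e(1,3) by (simp_all only: exp_pow.simps) (blast, simp add: ac_simps)
      then show ?thesis by blast
    next
      assume "a \<in> exp_pow (E - {u}) (Suc k)"
      then have "e \<in> exp_pow (E - {u}) (Suc (Suc k))"
        using e False by (subst exp_pow.simps) blast
      then show ?thesis by blast
    qed
  qed
qed auto

lemma exp_pow_mono: "E \<subseteq> F \<Longrightarrow> exp_pow E k \<subseteq> exp_pow F k"
  by (induction k) auto

text \<open>The case that \<open>u = w + g\<close> is not among the summands of \<open>e\<close> is the interesting one. There, write
  \<open>e = d + s\<close> with a single summand \<open>s\<close>. At the coordinates where \<open>g\<close> is nonzero, \<open>w\<close> vanishes, hence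
  so do all summands, hence \<open>d\<close>. At the other coordinates \<open>u\<close> agrees with \<open>w\<close>, which is at most \<open>s\<close>,
  so subtracting \<open>u\<close> from \<open>m + u\<close> and \<open>s\<close> from \<open>d + s\<close> preserves the inequality.\<close>
lemma split_exp_cancel:
  assumes split: "split_exp E u"
    and e: "e \<in> exp_pow E (Suc k)" "e \<preceq> m + u"
  shows "\<exists>d\<in>exp_pow E k. d \<preceq> m"
proof -
  obtain w g where cop: "\<And>y. min (lookup w y) (lookup g y) = 0" and u: "u = w + g"
    and meet: "\<And>s y. s \<in> E - {u} \<Longrightarrow> min (lookup s y) (lookup u y) = lookup w y"
    using split unfolding split_exp_def by blast
  from exp_pow_Suc_cases[OF e(1), of u] show ?thesis
  proof
    assume "\<exists>d\<in>exp_pow E k. e = d + u"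
    then obtain d where "d \<in> exp_pow E k" "e = d + u" by blast
    then show ?thesis using e(2) by (auto simp: le_exp_def lookup_add)
  next
    assume "e \<in> exp_pow (E - {u}) (Suc k)"
    then obtain d s where ds: "e = d + s" "d \<in> exp_pow (E - {u}) k" "s \<in> E - {u}" by auto
    have zero: "lookup s y = 0" if "s \<in> E - {u}" "lookup g y \<noteq> 0" for s y
      using cop[of y] meet[OF that(1), of y] that(2) by (auto simp: u lookup_add min_def split: if_splits)
    have zero_pow: "lookup d y = 0" if "d \<in> exp_pow (E - {u}) j" "lookup g y \<noteq> 0" for d y j
      using that by (induction j arbitrary: d) (auto simp: lookup_add zero)
    have "lookup d y \<le> lookup m y" for y
    proof (cases "lookup g y = 0")
      case True
      then have "lookup u y = lookup w y" by (simp add: u lookup_add)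
      then have "lookup u y \<le> lookup s y" using meet[OF ds(3), of y] by simp
      moreover have "lookup d y + lookup s y \<le> lookup m y + lookup u y"
        using e(2) by (simp add: le_exp_def ds(1) lookup_add)
      ultimately show ?thesis by simp
    next
      case False
      then show ?thesis using zero_pow[OF ds(2)] by simp
    qed
    moreover have "d \<in> exp_pow E k"
      using ds(2) exp_pow_mono[of "E - {u}" E k] by blast
    ultimately show ?thesis by (auto simp: le_exp_def)
  qed
qed

lemma keys_mult_mono_of: "m \<in> keys p \<Longrightarrow>
    m + u \<in> keys (p * (mono_of u :: ('v, 'k::field) mpol))"
  by (rule add_in_keys_mult) auto

text \<open>It is enough to test the colon ideal against the split generator: multiplication by a monomial
  shifts the exponents of a polynomial, so \<open>split_exp_cancel\<close> applies to each of its terms.\<close>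
theorem separable_imp_strong_persistence:
  fixes I :: "('v, 'k::field) mpol set"
  assumes "separable V I"
  shows "strong_persistence (poly_ring V) I"
proof -
  obtain p where mi: "monomial_ideal V I" and p: "split_generator V I p"
    using assms by (auto simp: separable_def)
  then obtain E0 where E0: "\<And>e. e \<in> E0 \<Longrightarrow> keys e \<subseteq> V"
    and I0: "I = Idl\<^bsub>poly_ring V\<^esub> (mono_of ` E0)"
    by (auto simp: monomial_ideal_def monomials_eq subset_image_iff)
  define E where "E = minimal_exps E0"
  have min: "is_min_monomial_gens V I (mono_of ` E)"
    unfolding E_def I0 using E0 by (rule is_min_monomial_gens_minimal_exps)
  have E: "keys e \<subseteq> V" if "e \<in> E" for e
    using that E0 by (auto simp: E_def minimal_exps_def)
  have I: "I = exp_ideal V E"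
    using min Idl_mono_of[OF E] by (auto simp: is_min_monomial_gens_def)
  obtain u where u: "split_exp E u"
    using p split_generator_iff[OF min] by blast
  have pow: "I [^]\<^bsub>ideals_set (poly_ring V)\<^esub> k = exp_ideal V (exp_pow E k)" for k :: nat
    unfolding I using E by (rule exp_ideal_pow)
  have "ideal_colon (poly_ring V) (exp_ideal V (exp_pow E (Suc k))) I = exp_ideal V (exp_pow E k)" for k
  proof
    show "ideal_colon (poly_ring V) (exp_ideal V (exp_pow E (Suc k))) I \<subseteq> exp_ideal V (exp_pow E k)"
    proof
      fix a assume a: "a \<in> ideal_colon (poly_ring V) (exp_ideal V (exp_pow E (Suc k))) I"
      have "mono_of u \<in> I"
        using u E by (auto simp: I mono_of_in_exp_ideal split_exp_def)
      then have prod: "a * mono_of u \<in> exp_ideal V (exp_pow E (Suc k))"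
        using a by (auto simp: ideal_colon_def)
      have "\<exists>d\<in>exp_pow E k. d \<preceq> m" if m: "m \<in> keys a" for m
      proof -
        obtain e where "e \<in> exp_pow E (Suc k)" "e \<preceq> m + u"
          using prod keys_mult_mono_of[OF m, of u] unfolding exp_ideal_def by blast
        then show ?thesis by (rule split_exp_cancel[OF u])
      qed
      then show "a \<in> exp_ideal V (exp_pow E k)"
        using a by (simp add: exp_ideal_def ideal_colon_def)
    qed
    show "exp_ideal V (exp_pow E k) \<subseteq> ideal_colon (poly_ring V) (exp_ideal V (exp_pow E (Suc k))) I"
      using exp_ideal_prod[of "exp_pow E k" V E, OF keys_exp_pow[OF E] E, where 'k='k]
        ideal_prod.prod[of _ "exp_ideal V (exp_pow E k)" _ I "poly_ring V"]
      by (auto simp: ideal_colon_def I exp_ideal_def)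
  qed
  then show ?thesis unfolding strong_persistence_def pow Suc_eq_plus1[symmetric] by blast
qed

section \<open>Closed neighborhood ideals\<close>

definition sqfree_exp :: "'v set \<Rightarrow> ('v \<Rightarrow>\<^sub>0 nat)" where
  "sqfree_exp A = (\<Sum>y\<in>A. single y 1)"

lemma lookup_sqfree_exp: "finite A \<Longrightarrow> lookup (sqfree_exp A) y = (if y \<in> A then 1 else 0)"
  by (simp add: sqfree_exp_def lookup_sum lookup_single when_def)

lemma keys_sqfree_exp: "finite A \<Longrightarrow> keys (sqfree_exp A) = A"
  by (auto simp: in_keys_iff lookup_sqfree_exp split: if_splits)

lemma le_sqfree_exp_iff: "finite A \<Longrightarrow> finite B \<Longrightarrow> sqfree_exp A \<preceq> sqfree_exp B \<longleftrightarrow> A \<subseteq> B"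
  by (auto simp: le_exp_def lookup_sqfree_exp)

lemma prod_indet:
  "finite A \<Longrightarrow> (\<Prod>y\<in>A. indet y) = (mono_of (sqfree_exp A) :: ('v, 'k::field) mpol)"
  by (induction rule: finite_induct) (simp_all add: sqfree_exp_def indet_def mult_single)

theorem theorem3p3:
  fixes G :: "('v, 'e) pre_digraph" and C X :: "'v set" and v :: 'v
  assumes "graph G"
    and "verts G = C \<union> {v} \<union> X"
    and "v \<notin> C" and "v \<notin> X" and "C \<inter> X = {}"
    and "C \<noteq> {}" and "is_clique G C"
    and "\<forall>c\<in>C. c \<rightarrow>\<^bsub>G\<^esub> v" and "\<forall>c\<in>C. \<forall>x\<in>X. c \<rightarrow>\<^bsub>G\<^esub> x"
    and "\<forall>x\<in>X. \<not> v \<rightarrow>\<^bsub>G\<^esub> x"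
  shows "separable (verts G) (CNI G :: ('v, 'k::field) mpol set)
    \<and> strong_persistence (poly_ring (verts G)) (CNI G :: ('v, 'k) mpol set)
    \<and> (X \<noteq> {} \<longrightarrow>
         split_generator (verts G) (CNI G :: ('v, 'k) mpol set) ((\<Prod>c\<in>C. indet c) * indet v))"
proof -
  interpret graph G by fact
  let ?V = "verts G" and ?N = "closed_nbhd G"
  let ?I = "CNI G :: ('v, 'k) mpol set"
  have sym: "x \<rightarrow>\<^bsub>G\<^esub> y \<Longrightarrow> y \<rightarrow>\<^bsub>G\<^esub> x" for x y
    using sym_arcs by (auto simp: symmetric_def sym_def)
  have fin: "finite C" "finite X" using finite_verts assms(2) by auto
  have N_sub: "?N y \<subseteq> ?V" if "y \<in> ?V" for y
    using that by (auto simp: closed_nbhd_def)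
  then have N_fin: "finite (?N y)" if "y \<in> ?V" for y
    using that finite_verts finite_subset by blast
  have NC: "?N c = ?V" if "c \<in> C" for c
    using that assms by (auto simp: closed_nbhd_def is_clique_def)
  have Nv: "?N v = insert v C"
    using assms sym by (auto simp: closed_nbhd_def)
  have NX: "?N x \<inter> insert v C = C" if "x \<in> X" for x
    using that assms sym by (auto simp: closed_nbhd_def)
  define E where "E = (\<lambda>y. sqfree_exp (?N y)) ` ?V"
  have E_keys: "keys e \<subseteq> ?V" if "e \<in> E" for e
    using that N_fin N_sub keys_sqfree_exp unfolding E_def by fastforce
  have "{\<Prod>z\<in>?N y. indet z |y. y \<in> ?V}
      = ((\<lambda>y. \<Prod>z\<in>?N y. indet z) ` ?V :: ('v, 'k) mpol set)" by blast
  also have "\<dots> = mono_of ` E"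
    unfolding E_def image_image using N_fin by (intro image_cong) (simp_all add: prod_indet)
  finally have I: "?I = Idl\<^bsub>poly_ring ?V\<^esub> (mono_of ` E)" by (simp add: CNI_def)
  have min: "is_min_monomial_gens ?V ?I (mono_of ` minimal_exps E)"
    unfolding I using E_keys by (rule is_min_monomial_gens_minimal_exps)
  \<comment> \<open>A neighborhood inside \<open>C \<union> {v}\<close> belongs to \<open>v\<close>, or to a member of \<open>C\<close> when \<open>X\<close> is empty.\<close>
  have u_in: "sqfree_exp (insert v C) \<in> minimal_exps E"
  proof -
    have nbhd: "?N y = insert v C" if y: "y \<in> ?V" and sub: "?N y \<subseteq> insert v C" for y
    proof -
      have "y \<notin> X" using sub assms by (auto simp: closed_nbhd_def)
      then show ?thesis using y sub assms(2) NC Nv N_sub by blast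
    qed
    have "d = sqfree_exp (insert v C)" if d: "d \<in> E" "d \<preceq> sqfree_exp (insert v C)" for d
    proof -
      obtain y where y: "y \<in> ?V" "d = sqfree_exp (?N y)" using d(1) by (auto simp: E_def)
      have "?N y \<subseteq> insert v C"
        using d(2) fin(1) N_fin[OF y(1)] by (simp add: y(2) le_sqfree_exp_iff)
      from nbhd[OF y(1) this] show ?thesis by (simp only: y(2))
    qed
    moreover have "sqfree_exp (insert v C) \<in> E"
      using Nv assms(2) by (force simp: E_def)
    ultimately show ?thesis unfolding minimal_exps_def by blast
  qed
  have u_eq: "(\<Prod>c\<in>C. indet c) * indet v = (mono_of (sqfree_exp (insert v C)) :: ('v, 'k) mpol)"
    using fin assms(3) prod_indet[of "insert v C", where 'k='k] by (simp add: mult.commute)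
  \<comment> \<open>A member of \<open>C\<close> yields the product of all indeterminates, a multiple of \<open>u\<close>; it is therefore
    redundant unless it equals \<open>u\<close>.\<close>
  have others: "\<exists>x\<in>X. e = sqfree_exp (?N x)"
    if e: "e \<in> minimal_exps E" "e \<noteq> sqfree_exp (insert v C)" for e
  proof -
    obtain y where y: "y \<in> ?V" "e = sqfree_exp (?N y)"
      using e by (auto simp: minimal_exps_def E_def)
    have "y \<notin> C"
    proof
      assume "y \<in> C"
      then have "sqfree_exp (insert v C) \<preceq> e"
        using y NC assms(2) fin by (auto simp: le_sqfree_exp_iff)
      then show False using e u_in by (auto simp: minimal_exps_def)
    qed
    moreover have "y \<noteq> v" using y e(2) Nv by auto
    ultimately show ?thesis using y assms(2) by blast
  qed
  have split: "split_exp (minimal_exps E) (sqfree_exp (insert v C))"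
    unfolding split_exp_def
  proof (intro conjI exI ballI allI)
    show "sqfree_exp (insert v C) \<in> minimal_exps E" by (fact u_in)
    show "sqfree_exp C \<noteq> 0"
      using keys_sqfree_exp[OF fin(1)] assms(6) by force
    show "min (lookup (sqfree_exp C) y) (lookup (sqfree_exp {v}) y) = 0" for y
      using fin assms(3) by (auto simp: lookup_sqfree_exp)
    show "sqfree_exp (insert v C) = sqfree_exp C + sqfree_exp {v}"
      using fin assms(3) by (simp add: sqfree_exp_def add.commute)
    show "min (lookup s y) (lookup (sqfree_exp (insert v C)) y) = lookup (sqfree_exp C) y"
      if s: "s \<in> minimal_exps E - {sqfree_exp (insert v C)}" for s y
    proof -
      obtain x where x: "x \<in> X" "s = sqfree_exp (?N x)" using others s by blast
      then have "finite (?N x)" using N_fin assms(2) by blast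
      then show ?thesis
        using NX[OF x(1)] fin by (auto simp: x(2) lookup_sqfree_exp)
    qed
  qed
  have gen: "split_generator ?V ?I ((\<Prod>c\<in>C. indet c) * indet v)"
    using split split_generator_iff[OF min] u_eq by blast
  then have "separable ?V ?I" by (auto simp: separable_def split_generator_def)
  then show ?thesis using gen separable_imp_strong_persistence by blast
qed

end
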